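(* Let $a,b$ be positive integers with $\gcd(a,b)=1$ such that $\{a,b\}$ is a minimal set of generators of the numerical semigroup $\langle a,b\rangle$. Then for every non-negative integer $p$, the $p$-numerical semigroup $S_p(a,b)$ is $p$-symmetric.
   Context: For a finite set $A=\{a_1,\dots,a_k\}$ ($k\ge 2$) of positive integers with $\gcd(a_1,\dots,a_k)=1$, let $d(n;A)$ be the number of tuples $(x_1,\dots,x_k)$ of non-negative integers with $a_1x_1+\cdots+a_kx_k=n$. For an integer $p\ge 0$ put $S_p(A)=\{n\in\mathbb N_0 : d(n;A)>p\}$ (the $p$-numerical semigroup of $A$) and $G_p(A)=\mathbb N_0\setminus S_p(A)$. Let $g_p(A)=\max G_p(A)$ and let $\ell_0(p)=\min S_p(A)$ (so $\ell_0(0)=0$). $S_p(A)$ is called $p$-symmetric if for all $x\in\mathbb Z\setminus S_p(A)$ one has $\ell_0(p)+g_p(A)-x\in S_p(A)$. Here $S_p(a,b)$ means $S_p(\{a,b\})$. A minimal set of generators is a generating set no proper subset of which generates the same semigroup. *)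

theory Defs
  imports Complex_Main "HOL-Library.FuncSet"
begin

text \<open>A tuple of coefficients for a finite set \<open>A\<close> is an extensional function on \<open>A\<close>, so that
  each tuple is counted exactly once. Only finite sets \<open>A\<close> of positive integers are meaningful
  here: otherwise \<^const>\<open>sum\<close> or \<^const>\<open>card\<close> may return the default value 0.\<close>

definition num_reps :: "nat \<Rightarrow> nat set \<Rightarrow> nat" where
  "num_reps n A = card {x \<in> A \<rightarrow>\<^sub>E (UNIV :: nat set). (\<Sum>a\<in>A. a * x a) = n}"

definition p_semigroup :: "nat \<Rightarrow> nat set \<Rightarrow> nat set" where
  "p_semigroup p A = {n. num_reps n A > p}"

definition p_gaps :: "nat \<Rightarrow> nat set \<Rightarrow> nat set" where
  "p_gaps p A = UNIV - p_semigroup p A"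

text \<open>This is the maximum of the set of \<open>p\<close>-gaps whenever that set is finite and nonempty,
  and unspecified otherwise (e.g. for \<open>p = 0\<close> and \<open>1 \<in> A\<close>).\<close>

definition p_frobenius :: "nat \<Rightarrow> nat set \<Rightarrow> nat" where
  "p_frobenius p A = Max (p_gaps p A)"

text \<open>The \<open>p\<close>-numerical semigroup is usually infinite, hence \<open>LEAST\<close> rather than \<^const>\<open>Min\<close>.\<close>

definition p_least :: "nat \<Rightarrow> nat set \<Rightarrow> nat" where
  "p_least p A = (LEAST n. n \<in> p_semigroup p A)"

text \<open>The quantifier ranges over all integers outside the semigroup, negative ones included.\<close>

definition p_symmetric :: "nat \<Rightarrow> nat set \<Rightarrow> bool" where
  "p_symmetric p A \<longleftrightarrow>
     (\<forall>x::int. x \<notin> int ` p_semigroup p A \<longrightarrow>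
        int (p_least p A) + int (p_frobenius p A) - x \<in> int ` p_semigroup p A)"

text \<open>The submonoid of the natural numbers generated by \<open>A\<close>, i.e. all sums of finitely many
  (possibly zero, possibly repeated) elements of \<open>A\<close>.\<close>

inductive_set generated_semigroup :: "nat set \<Rightarrow> nat set" for A :: "nat set" where
  zero: "0 \<in> generated_semigroup A"
| add: "a \<in> A \<Longrightarrow> n \<in> generated_semigroup A \<Longrightarrow> a + n \<in> generated_semigroup A"

definition minimal_generating_set :: "nat set \<Rightarrow> nat set \<Rightarrow> bool" where
  "minimal_generating_set A S \<longleftrightarrow>
     generated_semigroup A = S \<and> (\<forall>B. B \<subset> A \<longrightarrow> generated_semigroup B \<noteq> S)"

end

theory Submission
  imports Defs "HOL-Number_Theory.Cong"
begin

text \<open>The \<open>a\<close>-coefficients of the representations of \<open>n\<close> by coprime \<open>a\<close> and \<open>b\<close> form an arithmetic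
  progression with step \<open>b\<close>. So \<open>n\<close> has more than \<open>p\<close> representations iff one of them has
  \<open>a\<close>-coefficient at least \<open>p b\<close>, i.e. \<open>S\<^sub>p = p a b + S\<^sub>0\<close>. Sylvester's symmetry of \<open>S\<^sub>0\<close> (exactly
  one of \<open>z\<close> and \<open>a b - a - b - z\<close> lies in \<open>S\<^sub>0\<close>) is then transported by the shift: minimum and
  Frobenius number both move by \<open>p a b\<close>.\<close>

text \<open>An infinite set would have \<open>card\<close> equal to the default 0, so lower bounds
  on \<open>num_reps\<close> rest on this finiteness.\<close>

lemma finite_representations:
  fixes a b n :: nat
  assumes "a > 0" "b > 0"
  shows "finite {f \<in> {a, b} \<rightarrow>\<^sub>E (UNIV :: nat set). (\<Sum>c\<in>{a, b}. c * f c) = n}"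
proof (rule finite_subset)
  show "{f \<in> {a, b} \<rightarrow>\<^sub>E UNIV. (\<Sum>c\<in>{a, b}. c * f c) = n} \<subseteq> {a, b} \<rightarrow>\<^sub>E {..n}"
  proof
    fix f assume f: "f \<in> {f \<in> {a, b} \<rightarrow>\<^sub>E UNIV. (\<Sum>c\<in>{a, b}. c * f c) = n}"
    have "f c \<le> n" if "c \<in> {a, b}" for c
    proof -
      have "c > 0" using that assms by auto
      then have "f c \<le> c * f c" by simp
      also have "\<dots> \<le> (\<Sum>c\<in>{a, b}. c * f c)"
        by (rule member_le_sum) (use that in auto)
      finally show ?thesis using f by simp
    qed
    with f show "f \<in> {a, b} \<rightarrow>\<^sub>E {..n}" by (auto simp: PiE_iff)
  qed
qed (simp add: finite_PiE)

lemma num_reps_pair_gt_iff: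
  fixes a b n p :: nat
  assumes "a > 0" "b > 0" "a \<noteq> b" "coprime a b"
  shows "num_reps n {a, b} > p \<longleftrightarrow> (\<exists>x y. n = p * a * b + a * x + b * y)"
proof -
  define R where "R = {f \<in> {a, b} \<rightarrow>\<^sub>E (UNIV :: nat set). (\<Sum>c\<in>{a, b}. c * f c) = n}"
  have R_iff: "f \<in> R \<longleftrightarrow> f \<in> extensional {a, b} \<and> a * f a + b * f b = n" for f
    using assms by (auto simp: R_def PiE_def)
  have fin: "finite R" unfolding R_def using assms by (intro finite_representations)
  have num: "num_reps n {a, b} = card R" by (simp add: num_reps_def R_def)
  show ?thesis
  proof
    assume "num_reps n {a, b} > p"
    show "\<exists>x y. n = p * a * b + a * x + b * y"
    proof (rule ccontr)
      assume no: "\<nexists>x y. n = p * a * b + a * x + b * y"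
      \<comment> \<open>Otherwise \<open>p * b\<close> copies of \<open>a\<close> could be split
        off, giving the excluded form of \<open>n\<close>.\<close>
      have "f a div b < p" if "f \<in> R" for f
      proof (rule ccontr)
        assume "\<not> f a div b < p"
        then have "p * b \<le> f a div b * b" by (intro mult_right_mono) auto
        also have "\<dots> \<le> f a" by simp
        finally obtain x where "f a = p * b + x" using le_Suc_ex by blast
        then have "n = p * a * b + a * x + b * f b"
          using that by (auto simp: R_iff algebra_simps)
        with no show False by blast
      qed
      then have image: "(\<lambda>f. f a div b) ` R \<subseteq> {..<p}" by auto
      \<comment> \<open>Since \<open>a\<close> is invertible mod \<open>b\<close>, \<open>n\<close>
        fixes the residue of \<open>f a\<close> mod \<open>b\<close>. The quotient then determines
        \<open>f a\<close>, hence \<open>f\<close>, so at most \<open>p\<close> representations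
        remain.\<close>
      have "inj_on (\<lambda>f. f a div b) R"
      proof (rule inj_onI)
        fix f g assume f: "f \<in> R" and g: "g \<in> R" and eq: "f a div b = g a div b"
        have sums: "a * f a + b * f b = a * g a + b * g b" using f g by (simp add: R_iff)
        then have "(a * f a + b * f b) mod b = (a * g a + b * g b) mod b" by (rule arg_cong)
        then have "[a * f a = a * g a] (mod b)" by (simp add: cong_def)
        then have "[f a = g a] (mod b)"
          using assms(4) by (simp add: cong_mult_lcancel_nat)
        then have fa: "f a = g a" using eq by (metis cong_def div_mult_mod_eq)
        then have "f b = g b" using sums \<open>b > 0\<close> by simp
        then show "f = g" using f g fa
          by (intro extensionalityI[of _ "{a, b}"]) (auto simp: R_iff)
      qed
      then have "card R \<le> card {..<p}" using image by (intro card_inj_on_le) auto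
      then show False using \<open>num_reps n {a, b} > p\<close> num by simp
    qed
  next
    assume "\<exists>x y. n = p * a * b + a * x + b * y"
    then obtain x y where n: "n = p * a * b + a * x + b * y" by blast
    \<comment> \<open>Start from the coefficients \<open>x + p * b\<close> and \<open>y\<close>, and
      trade \<open>b\<close> copies of \<open>a\<close> for \<open>a\<close> copies of
      \<open>b\<close>, \<open>i\<close> times. The values \<open>i = 0, ..., p\<close> give
      \<open>p + 1\<close> representations, told apart by their value at \<open>b\<close>.\<close>
    define F where
      "F i = (\<lambda>c\<in>{a, b}. if c = a then x + (p - i) * b else y + i * a)" for i
    have "F i \<in> R" if "i \<le> p" for i
    proof -
      obtain j where p: "p = i + j" using \<open>i \<le> p\<close> le_Suc_ex by blast
      show ?thesis using assms(3) unfolding R_iff F_def n p by (simp add: algebra_simps)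
    qed
    moreover have "inj_on F {..p}"
    proof (rule inj_onI)
      fix i j assume "F i = F j"
      then have "F i b = F j b" by simp
      then show "i = j" using assms by (simp add: F_def split: if_splits)
    qed
    ultimately have "card {..p} \<le> card R" using fin by (intro card_inj_on_le) auto
    then show "num_reps n {a, b} > p" using num by simp
  qed
qed

text \<open>Write \<open>z = a * r + b * s\<close> with \<open>0 \<le> r < b\<close> and
  \<open>s\<close> an integer. The reflection of \<open>z\<close> has coefficients
  \<open>b - 1 - r\<close> and \<open>-1 - s\<close>, so the sign of \<open>s\<close> decides which
  of the two is representable.\<close>

lemma sylvester_symmetry_cover:
  fixes a b :: nat and z :: int
  assumes "b > 0" "coprime a b"
  obtains x y :: nat where "z = int a * int x + int b * int y"
  | x y :: nat where "int a * int b - int a - int b - z = int a * int x + int b * int y"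
proof -
  obtain u where u: "[int a * u = z] (mod int b)"
    using assms by (metis cong_solve_coprime_int coprime_int_iff cong_scalar_right mult.assoc mult_1)
  define r where "r = u mod int b"
  have r: "0 \<le> r" "r < int b" using assms by (auto simp: r_def)
  have "[int a * r = z] (mod int b)"
    using u by (simp add: r_def cong_def mod_mult_right_eq)
  then obtain s where s: "z = int a * r + int b * s"
    by (metis cong_iff_lin)
  show thesis
  proof (cases "s \<ge> 0")
    case True
    then show thesis using that(1)[of "nat r" "nat s"] r s by simp
  next
    case False
    have "int a * int b - int a - int b - z = int a * (int b - 1 - r) + int b * (-1 - s)"
      by (simp add: s algebra_simps)
    then show thesis using that(2)[of "nat (int b - 1 - r)" "nat (-1 - s)"] r False by simp
  qed
qed

text \<open>Adding \<open>a + b\<close> would give \<open>a * b\<close> with both coefficients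
  positive. Coprimality forces \<open>b\<close> to divide the first one, so its term alone already
  reaches \<open>a * b\<close>.\<close>

lemma sylvester_frobenius_not_representable:
  fixes a b x y :: nat
  assumes "a > 0" "b > 0" "coprime a b"
  shows "int a * int b - int a - int b \<noteq> int a * int x + int b * int y"
proof
  assume "int a * int b - int a - int b = int a * int x + int b * int y"
  then have "int (a * b) = int (a * Suc x + b * Suc y)" by (simp add: algebra_simps)
  then have eq: "a * b = a * Suc x + b * Suc y" by (simp only: of_nat_eq_iff)
  have "b dvd a * b" by simp
  then have "b dvd a * Suc x" using eq by (metis dvd_add_left_iff dvd_triv_left)
  then have "b dvd Suc x" using assms(3) by (metis coprime_commute coprime_dvd_mult_right_iff)
  then have "b \<le> Suc x" by (rule dvd_imp_le) simp
  then have "a * b \<le> a * Suc x" by (rule mult_le_mono2)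
  moreover have "b * Suc y > 0" using assms by simp
  ultimately show False using eq by linarith
qed

lemma generated_semigroup_one:
  assumes "1 \<in> A"
  shows "generated_semigroup A = UNIV"
proof -
  have "n \<in> generated_semigroup A" for n
    by (induction n) (use generated_semigroup.intros assms in force)+
  then show ?thesis by blast
qed

text \<open>If 1 were a generator, the proper subset \<open>{1}\<close> would already generate
  everything.\<close>

lemma minimal_generating_pair_not_one:
  fixes a b :: nat
  assumes "a \<noteq> b" "minimal_generating_set {a, b} (generated_semigroup {a, b})"
  shows "a \<noteq> 1" "b \<noteq> 1"
proof -
  have "1 \<notin> {a, b}"
  proof
    assume one: "1 \<in> {a, b}"
    then have "{1} \<subset> {a, b}" using assms(1) by auto
    moreover have "generated_semigroup {1} = generated_semigroup {a, b}"
      using generated_semigroup_one[OF one] generated_semigroup_one[of "{1}"] by simp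
    ultimately show False using assms(2) unfolding minimal_generating_set_def by blast
  qed
  then show "a \<noteq> 1" "b \<noteq> 1" by auto
qed

theorem theorem1:
  fixes a b p :: nat
  assumes "a > 0" and "b > 0" and "a \<noteq> b"
    and "gcd a b = 1"
    and "minimal_generating_set {a, b} (generated_semigroup {a, b})"
  shows "p_symmetric p {a, b}"
proof -
  have cop: "coprime a b" using assms(4) by (simp add: coprime_iff_gcd_eq_1)
  have ab2: "a \<ge> 2" "b \<ge> 2"
    using minimal_generating_pair_not_one[OF assms(3,5)] assms(1,2) by linarith+
  have S: "p_semigroup p {a, b} = {n. \<exists>x y. n = p * a * b + a * x + b * y}"
    using num_reps_pair_gt_iff[OF assms(1-3) cop] by (simp add: p_semigroup_def)
  have int_S: "z \<in> int ` p_semigroup p {a, b} \<longleftrightarrow>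
    (\<exists>x y :: nat. z - int p * int a * int b = int a * int x + int b * int y)" for z
  proof -
    have "z \<in> int ` p_semigroup p {a, b} \<longleftrightarrow>
      (\<exists>x y :: nat. z = int (p * a * b + a * x + b * y))"
      unfolding S by blast
    then show ?thesis by (simp add: algebra_simps)
  qed
  have least: "p_least p {a, b} = p * a * b"
    unfolding p_least_def
  proof (rule Least_equality)
    have "p * a * b = p * a * b + a * 0 + b * 0" by simp
    then show "p * a * b \<in> p_semigroup p {a, b}" unfolding S by blast
  qed (auto simp: S)
  \<comment> \<open>Both generators being at least 2 makes this number non-negative, so
    \<open>nat\<close> does not truncate it below and a gap exists even for
    \<open>p = 0\<close>.\<close>
  have "int a * int b - int a - int b = (int a - 1) * (int b - 1) - 1"
    by (simp add: algebra_simps)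
  moreover have "(int a - 1) * (int b - 1) \<ge> 1 * 1" using ab2 by (intro mult_mono) auto
  ultimately have F_nonneg: "0 \<le> int a * int b - int a - int b" by linarith
  define F where "F = nat (int a * int b - int a - int b)"
  have F: "int F = int a * int b - int a - int b" using F_nonneg by (simp add: F_def)
  have F_gap: "p * a * b + F \<in> p_gaps p {a, b}"
  proof -
    have "int (p * a * b + F) \<notin> int ` p_semigroup p {a, b}"
      using sylvester_frobenius_not_representable[OF assms(1,2) cop]
      unfolding int_S by (simp add: F)
    then show ?thesis unfolding p_gaps_def by blast
  qed
  have gap_le: "n \<le> p * a * b + F" if "n \<in> p_gaps p {a, b}" for n
  proof -
    have no: "int n \<notin> int ` p_semigroup p {a, b}" using that by (auto simp: p_gaps_def)
    show ?thesis
    proof (cases rule: sylvester_symmetry_cover[OF assms(2) cop, of "int n - int p * int a * int b"])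
      case (1 x y)
      then show ?thesis using no unfolding int_S by blast
    next
      \<comment> \<open>The reflection of the shifted gap is representable, hence non-negative,
        which is the desired bound.\<close>
      case (2 x y)
      then have "int F - (int n - int (p * a * b)) = int (a * x + b * y)" by (simp add: F)
      then show ?thesis by linarith
    qed
  qed
  have frob: "p_frobenius p {a, b} = p * a * b + F"
    unfolding p_frobenius_def
  proof (rule Max_eqI)
    show "finite (p_gaps p {a, b})"
      using gap_le by (auto intro: finite_subset[of _ "{..p * a * b + F}"])
  qed (use gap_le F_gap in auto)
  show ?thesis
    unfolding p_symmetric_def
  proof (intro allI impI)
    fix z :: int assume no: "z \<notin> int ` p_semigroup p {a, b}"
    show "int (p_least p {a, b}) + int (p_frobenius p {a, b}) - z \<in> int ` p_semigroup p {a, b}"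
    proof (cases rule: sylvester_symmetry_cover[OF assms(2) cop, of "z - int p * int a * int b"])
      case (1 x y)
      then show ?thesis using no unfolding int_S by blast
    next
      case (2 x y)
      \<comment> \<open>Minimum and Frobenius number add up to \<open>2 * p * a * b + F\<close>;
        removing one shift leaves \<open>F - (z - p * a * b)\<close>, the reflection in the
        unshifted semigroup.\<close>
      then have "int (p_least p {a, b}) + int (p_frobenius p {a, b}) - z - int p * int a * int b
        = int a * int x + int b * int y"
        by (simp add: least frob F algebra_simps)
      then show ?thesis unfolding int_S by blast
    qed
  qed
qed

end
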